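(* Let $X$ be a Hausdorff locally convex topological vector space, let $K$ be a nonempty convex compact subset of $X$, let $D\subseteq K$ be a self segment-dense set in $K$, and let $F:K\times K\rightrightarrows\mathbb{R}$ be a set-valued map satisfying: (i) for all $y\in D$, the map $x\mapsto F(x,y)$ is lower semicontinuous on $K$; (ii) for all $x\in K$, the map $y\mapsto F(x,y)$ is lower semicontinuous on $K\setminus D$; (iii') for all $x\in D$, the map $y\mapsto F(x,y)$ is convex on $D$; (iv') for all $x\in D$, $F(x,x)\le 0$. Then there exists $x_0\in K$ such that $F(x_0,y)\le 0$ for all $y\in K$.
   Context: Self segment-dense: for $U\subseteq V\subseteq X$ with $V$ convex, $U$ is self segment-dense in $V$ if $U$ is dense in $V$ (i.e. $V\subseteq\operatorname{cl}(U)$) and for all $x,y\in U$ the set $[x,y]\cap U$ is dense in the closed segment $[x,y]=\{x+t(y-x):t\in[0,1]\}$. Notation: $F(x,y)\le 0$ means $u\le 0$ for all $u\in F(x,y)$. Lower semicontinuity: a set-valued map $T:A\rightrightarrows\mathbb{R}$ on a topological space $A$ (here $A=K$ with the subspace topology), with domain $D(T)=\{x\in A:T(x)\ne\emptyset\}$, is lower semicontinuous at $x\in D(T)$ if for every open $N\subseteq\mathbb{R}$ with $T(x)\cap N\neq\emptyset$ there is a neighborhood $M$ of $x$ in $A$ such that $T(y)\cap N\ne\emptyset$ for every $y\in M\cap D(T)$. It is lower semicontinuous on $S\subseteq A$ if it is lower semicontinuous at every point of $S$ (so in particular $S\subseteq D(T)$); here $T$ is still regarded as a map on all of $A$. Convexity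 on a not necessarily convex set: $T$ is convex on $D$ if for all $x_1,\dots,x_n\in D$ and $\lambda_i\ge0$ with $\sum_{i=1}^n\lambda_i=1$ and $\sum_{i=1}^n\lambda_ix_i\in D$ one has $\sum_{i=1}^n\lambda_iT(x_i)\subseteq T\left(\sum_{i=1}^n\lambda_ix_i\right)$ (Minkowski sum). *)

theory Defs
  imports "HOL-Analysis.Analysis"
begin

text \<open>The Hausdorff axiom is not part of these classes; it is added through \<^class>\<open>t2_space\<close>.\<close>

class topological_real_vector = real_vector + topological_ab_group_add +
  assumes tendsto_scaleR_Pair:
    "filterlim (\<lambda>z. fst z *\<^sub>R snd z) (nhds (a *\<^sub>R x)) (nhds a \<times>\<^sub>F nhds x)"

text \<open>The first conjunct is \<^term>\<open>convex C\<close> unfolded: the constant \<^const>\<open>convex\<close> cannot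
  be applied to the class parameter type in the class specification itself.\<close>

class locally_convex_space = topological_real_vector +
  assumes ex_convex_nhds_0:
    "open U \<Longrightarrow> 0 \<in> U \<Longrightarrow>
      \<exists>C. (\<forall>x\<in>C. \<forall>y\<in>C. \<forall>u\<ge>0. \<forall>v\<ge>0. u + v = 1 \<longrightarrow> u *\<^sub>R x + v *\<^sub>R y \<in> C) \<and>
        C \<subseteq> U \<and> eventually (\<lambda>x. x \<in> C) (nhds 0)"

lemma convex_nhds_0:
  fixes U :: "'a::locally_convex_space set"
  assumes "open U" and "0 \<in> U"
  shows "\<exists>C. convex C \<and> C \<subseteq> U \<and> eventually (\<lambda>x. x \<in> C) (nhds 0)"
  using ex_convex_nhds_0[OF assms] unfolding convex_def .

instance real_normed_vector \<subseteq> locally_convex_space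
proof
  fix a :: real and x :: 'a
  show "filterlim (\<lambda>z. fst z *\<^sub>R snd z) (nhds (a *\<^sub>R x)) (nhds a \<times>\<^sub>F nhds x)"
    by (intro tendsto_scaleR filterlim_fst filterlim_snd)
next
  fix U :: "'a set"
  assume "open U" "0 \<in> U"
  then obtain e where "e > 0" "ball 0 e \<subseteq> U"
    by (meson open_contains_ball)
  then have "\<exists>C. convex C \<and> C \<subseteq> U \<and> eventually (\<lambda>x. x \<in> C) (nhds 0)"
    by (intro exI[of _ "ball 0 e"] conjI convex_ball eventually_nhds_in_open) auto
  then show "\<exists>C. (\<forall>x\<in>C. \<forall>y\<in>C. \<forall>u\<ge>0. \<forall>v\<ge>0. u + v = 1 \<longrightarrow> u *\<^sub>R x + v *\<^sub>R y \<in> C) \<and>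
      C \<subseteq> U \<and> eventually (\<lambda>x. x \<in> C) (nhds 0)"
    unfolding convex_def .
qed

definition self_segment_dense :: "'a::{real_vector,topological_space} set \<Rightarrow> 'a set \<Rightarrow> bool"
  where "self_segment_dense U V \<longleftrightarrow>
    convex V \<and> U \<subseteq> V \<and> V \<subseteq> closure U \<and>
    (\<forall>x\<in>U. \<forall>y\<in>U. closed_segment x y \<subseteq> closure (closed_segment x y \<inter> U))"

text \<open>A set-valued map on \<open>A\<close> is a function \<open>T :: 'a \<Rightarrow> 'b set\<close> whose values
  outside \<open>A\<close> are irrelevant.\<close>

definition sv_domain :: "'a set \<Rightarrow> ('a \<Rightarrow> 'b set) \<Rightarrow> 'a set"
  where "sv_domain A T = {x \<in> A. T x \<noteq> {}}"

definition sv_lsc_at ::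
    "'a::topological_space set \<Rightarrow> ('a \<Rightarrow> 'b::topological_space set) \<Rightarrow> 'a \<Rightarrow> bool"
  where "sv_lsc_at A T x \<longleftrightarrow>
    x \<in> sv_domain A T \<and>
    (\<forall>N. open N \<and> T x \<inter> N \<noteq> {} \<longrightarrow>
      (\<exists>M. openin (top_of_set A) M \<and> x \<in> M \<and>
        (\<forall>y \<in> M \<inter> sv_domain A T. T y \<inter> N \<noteq> {})))"

text \<open>\<open>T\<close> is lower semicontinuous at each point of \<open>S\<close>, as a map on all of \<open>A\<close>;
  neighbourhoods are not restricted to \<open>S\<close>.\<close>

definition sv_lsc_on ::
    "'a::topological_space set \<Rightarrow> ('a \<Rightarrow> 'b::topological_space set) \<Rightarrow> 'a set \<Rightarrow> bool"
  where "sv_lsc_on A T S \<longleftrightarrow> (\<forall>x\<in>S. sv_lsc_at A T x)"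

text \<open>The set \<open>D\<close> need not be convex. The sum of sets is the Minkowski sum.\<close>

definition sv_convex_on :: "'a::real_vector set \<Rightarrow> ('a \<Rightarrow> 'b::real_vector set) \<Rightarrow> bool"
  where "sv_convex_on D T \<longleftrightarrow>
    (\<forall>(n::nat) (x :: nat \<Rightarrow> 'a) (l :: nat \<Rightarrow> real).
      (\<forall>i\<in>{1..n}. x i \<in> D \<and> 0 \<le> l i) \<and> (\<Sum>i=1..n. l i) = 1 \<and>
      (\<Sum>i=1..n. l i *\<^sub>R x i) \<in> D \<longrightarrow>
      (\<Sum>i=1..n. (\<lambda>v. l i *\<^sub>R v) ` T (x i)) \<subseteq> T (\<Sum>i=1..n. l i *\<^sub>R x i))"

end

theory Submission
  imports Defs
begin

text \<open>The sets \<open>G y = {x \<in> K. F x y \<le> 0}\<close>, \<open>y \<in> D\<close>, are closed by (i). Convexity and (iv') show that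
  the points of \<open>D\<close> in the convex hull of a finite \<open>Z \<subseteq> D\<close> are covered by the \<open>G z\<close>, \<open>z \<in> Z\<close>;
  since \<open>D\<close> is self segment-dense, those points are dense in the hull, so the whole hull is
  covered. By the KKM principle and compactness some \<open>x0\<close> lies in all \<open>G y\<close>, \<open>y \<in> D\<close>, and (ii)
  extends \<open>F x0 y \<le> 0\<close> from the dense set \<open>D\<close> to \<open>K\<close>.\<close>

section \<open>Brouwer's theorem on the cube [0,1]^n\<close>

text \<open>The library's Brouwer theorem fixes the dimension by a type, but the KKM principle needs
  the simplex on an arbitrary number of points. Points of Euclidean \<open>n\<close>-space are therefore
  sequences that vanish from index \<open>n\<close> on, and Brouwer's theorem is derived again from Kuhn's
  combinatorial lemma.\<close>

definition unit_box :: "nat \<Rightarrow> (nat \<Rightarrow> real) set"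
  where "unit_box n = {x. (\<forall>i<n. 0 \<le> x i \<and> x i \<le> 1) \<and> (\<forall>i\<ge>n. x i = 0)}"

text \<open>Tychonoff: the box is a product over all indices, with the factor {0} from
  \<open>n\<close> on.\<close>

lemma compact_unit_box: "compact (unit_box n)"
proof -
  have "unit_box n = PiE UNIV (\<lambda>i. if i < n then {0..1} else {0})"
    unfolding unit_box_def PiE_UNIV_domain Pi_iff set_eq_iff mem_Collect_eq
    by (metis (full_types) UNIV_I atLeastAtMost_iff linorder_not_le singletonD singletonI)
  then show ?thesis
    using compactin_PiE[of "\<lambda>_. euclidean" UNIV "\<lambda>i. if i < n then {0..1::real} else {0}"]
    by (simp add: euclidean_product_topology)
qed

lemma tendsto_coordinatewise_iff:
  fixes f :: "'a \<Rightarrow> 'b \<Rightarrow> 'c::topological_space"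
  shows "(f \<longlongrightarrow> l) G \<longleftrightarrow> (\<forall>i. ((\<lambda>x. f x i) \<longlongrightarrow> l i) G)"
  using limitin_componentwise[of "\<lambda>_. euclidean" UNIV f l G]
  by (simp add: euclidean_product_topology)

text \<open>Combinatorial core of Brouwer's theorem: in ever finer grids, Kuhn's lemma finds a cell
  with corners in every \<open>A i\<close> and every \<open>B i\<close>; along a subsequence these
  cells shrink to a single point.\<close>

lemma unit_box_covering:
  fixes A B :: "nat \<Rightarrow> (nat \<Rightarrow> real) set"
  assumes clA: "\<And>i. i < n \<Longrightarrow> closed (A i)" and clB: "\<And>i. i < n \<Longrightarrow> closed (B i)"
    and cover: "\<And>i x. i < n \<Longrightarrow> x \<in> unit_box n \<Longrightarrow> x \<in> A i \<union> B i"
    and A0: "\<And>i x. i < n \<Longrightarrow> x \<in> unit_box n \<Longrightarrow> x i = 0 \<Longrightarrow> x \<in> A i"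
    and B1: "\<And>i x. i < n \<Longrightarrow> x \<in> unit_box n \<Longrightarrow> x i = 1 \<Longrightarrow> x \<in> B i"
  shows "\<exists>x\<in>unit_box n. \<forall>i<n. x \<in> A i \<inter> B i"
proof -
  define pt where "pt k q = (\<lambda>i. if i < n then real (q i) / real (Suc k) else 0)"
    for k and q :: "nat \<Rightarrow> nat"
  \<comment> \<open>Label 0 guarantees membership in \<open>A i\<close>. Kuhn's lemma wants label 1
    on the upper face, so it is forced there; \<open>B1\<close> ensures that such points still lie
    in \<open>B i\<close>.\<close>
  define label where "label k q i = (if pt k q \<in> A i \<and> q i \<noteq> Suc k then 0 else (1::nat))"
    for k q i
  have pt_box: "pt k q \<in> unit_box n" if "\<forall>i<n. q i \<le> Suc k" for k q
    using that by (auto simp: unit_box_def pt_def)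
  have label_A: "pt k q \<in> A i" if "label k q i = 0" for k q i
    using that by (auto simp: label_def split: if_splits)
  have label_B: "pt k q \<in> B i" if "label k q i \<noteq> 0" "\<forall>i<n. q i \<le> Suc k" "i < n" for k q i
  proof (cases "q i = Suc k")
    case True
    then show ?thesis using B1[OF \<open>i < n\<close> pt_box] that by (simp add: pt_def)
  next
    case False
    then show ?thesis using cover[OF \<open>i < n\<close> pt_box] that by (auto simp: label_def split: if_splits)
  qed
  define near where "near k q c \<longleftrightarrow> (\<forall>j. \<bar>c j - pt k q j\<bar> \<le> 1 / real (Suc k))"
    for k q and c :: "nat \<Rightarrow> real"
  have nearI: "near k q (pt k r)" if "\<forall>j<n. q j \<le> r j \<and> r j \<le> q j + 1" for k q r
    unfolding near_def
  proof
    fix j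
    show "\<bar>pt k r j - pt k q j\<bar> \<le> 1 / real (Suc k)"
    proof (cases "j < n")
      case True
      then have "q j \<le> r j \<and> r j \<le> q j + 1" using that by blast
      then have "\<bar>real (r j) - real (q j)\<bar> \<le> 1" by linarith
      then show ?thesis
        using True by (simp add: pt_def divide_right_mono flip: diff_divide_distrib)
    qed (simp add: pt_def)
  qed
  have "\<exists>q. (\<forall>i<n. q i < Suc k) \<and>
      (\<forall>i<n. (\<exists>c\<in>A i. near k q c) \<and> (\<exists>c\<in>B i. near k q c))" for k
  proof -
    obtain q where q: "\<forall>i<n. q i < Suc k" and
      rs: "\<forall>i<n. \<exists>r s. (\<forall>j<n. q j \<le> r j \<and> r j \<le> q j + 1) \<and>
        (\<forall>j<n. q j \<le> s j \<and> s j \<le> q j + 1) \<and> label k r i \<noteq> label k s i"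
    proof (rule kuhn_lemma[of "Suc k" n "label k"])
      show "\<forall>x. (\<forall>i<n. x i \<le> Suc k) \<longrightarrow> (\<forall>i<n. x i = 0 \<longrightarrow> label k x i = 0)"
        using A0 pt_box by (auto simp: label_def pt_def)
    qed (auto simp: label_def)
    \<comment> \<open>Since \<open>q j < Suc k\<close> for the lower corner, every corner of the
      cell is still a grid point, as \<open>label_B\<close> requires.\<close>
    have le: "\<forall>j<n. r j \<le> Suc k" if "\<forall>j<n. q j \<le> r j \<and> r j \<le> q j + 1" for r
    proof (intro allI impI)
      fix j assume "j < n"
      then have "q j < Suc k" "r j \<le> q j + 1" using that q by blast+
      then show "r j \<le> Suc k" by linarith
    qed
    have "(\<exists>c\<in>A i. near k q c) \<and> (\<exists>c\<in>B i. near k q c)" if i: "i < n" for i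
    proof -
      obtain r s where r: "\<forall>j<n. q j \<le> r j \<and> r j \<le> q j + 1"
        and s: "\<forall>j<n. q j \<le> s j \<and> s j \<le> q j + 1" and ne: "label k r i \<noteq> label k s i"
        using rs i by blast
      show ?thesis
      proof (cases "label k r i = 0")
        case True
        then show ?thesis
          using ne label_A[of k r i] label_B[OF _ le[OF s] i] nearI[OF r] nearI[OF s] by auto
      next
        case False
        then have "label k s i = 0" using ne by (auto simp: label_def split: if_splits)
        then show ?thesis
          using False label_A[of k s i] label_B[OF _ le[OF r] i] nearI[OF r] nearI[OF s] by auto
      qed
    qed
    then show ?thesis using q by blast
  qed
  then obtain q where q: "\<And>k. \<forall>i<n. q k i < Suc k"
    and nearq: "\<And>k. \<forall>i<n. (\<exists>c\<in>A i. near k (q k) c) \<and> (\<exists>c\<in>B i. near k (q k) c)"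
    by metis
  have "\<forall>k. pt k (q k) \<in> unit_box n"
    using q by (auto intro!: pt_box less_imp_le)
  then obtain x \<phi> where x: "x \<in> unit_box n" and \<phi>: "strict_mono \<phi>"
    and lim: "((\<lambda>k. pt k (q k)) \<circ> \<phi>) \<longlonglongrightarrow> x"
    by (rule seq_compactE[OF compact_imp_seq_compact[OF compact_unit_box]])
  have inv0: "(\<lambda>k. 1 / real (Suc (\<phi> k))) \<longlonglongrightarrow> 0"
    using LIMSEQ_subseq_LIMSEQ[OF lim_inverse_n' [THEN LIMSEQ_Suc] \<phi>] by (simp add: o_def)
  \<comment> \<open>The chosen points stay within one mesh width of the convergent subsequence,
    hence share its limit.\<close>
  have in_closed: "x \<in> C" if "closed C" and nearC: "\<And>k. \<exists>c\<in>C. near k (q k) c" for C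
  proof -
    obtain c where c: "\<And>k. c k \<in> C" "\<And>k. near k (q k) (c k)"
      using nearC by metis
    have "(\<lambda>k. c (\<phi> k)) \<longlonglongrightarrow> x"
    proof (unfold tendsto_coordinatewise_iff, rule allI)
      fix j
      have "(\<lambda>k. c (\<phi> k) j - pt (\<phi> k) (q (\<phi> k)) j) \<longlonglongrightarrow> 0"
        by (rule Lim_null_comparison[OF always_eventually inv0]) (use c in \<open>simp add: near_def\<close>)
      moreover have "(\<lambda>k. pt (\<phi> k) (q (\<phi> k)) j) \<longlonglongrightarrow> x j"
        using lim[unfolded tendsto_coordinatewise_iff] by (simp add: o_def)
      ultimately show "(\<lambda>k. c (\<phi> k) j) \<longlonglongrightarrow> x j"
        using tendsto_add by fastforce
    qed
    then show ?thesis
      by (rule closed_sequentially[OF \<open>closed C\<close>, rotated]) (rule c(1))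
  qed
  have "x \<in> A i \<inter> B i" if "i < n" for i
    using in_closed[OF clA[OF that]] in_closed[OF clB[OF that]] nearq that by blast
  then show ?thesis using x by blast
qed

text \<open>Take for \<open>A i\<close> and \<open>B i\<close> the sets where
  \<open>x i \<le> f x i\<close> and \<open>f x i \<le> x i\<close>; a point common to all of them
  is fixed.\<close>

lemma brouwer_unit_box:
  assumes cont: "continuous_on (unit_box n) f" and f: "f ` unit_box n \<subseteq> unit_box n"
  shows "\<exists>x\<in>unit_box n. f x = x"
proof -
  have cl: "closed (unit_box n)"
    by (simp add: compact_imp_closed compact_unit_box)
  have cf: "continuous_on (unit_box n) (\<lambda>x. f x i)" for i
    by (rule continuous_on_product_then_coordinatewise[OF cont])
  have cx: "continuous_on (unit_box n) (\<lambda>x. x i)" for i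
    by (rule continuous_on_subset[OF continuous_on_product_coordinates]) simp
  have fb: "f x \<in> unit_box n" if "x \<in> unit_box n" for x using f that by blast
  have "\<exists>x\<in>unit_box n. \<forall>i<n. x \<in> {x\<in>unit_box n. x i \<le> f x i} \<inter> {x\<in>unit_box n. f x i \<le> x i}"
  proof (rule unit_box_covering)
    fix i x assume "i < n" "x \<in> unit_box n"
    then show "x i = 0 \<Longrightarrow> x \<in> {x \<in> unit_box n. x i \<le> f x i}"
      "x i = 1 \<Longrightarrow> x \<in> {x \<in> unit_box n. f x i \<le> x i}"
      using fb[of x] by (auto simp: unit_box_def)
  qed (auto intro!: continuous_on_closed_Collect_le cf cx cl)
  then obtain x where x: "x \<in> unit_box n" "\<And>i. i < n \<Longrightarrow> f x i = x i"
    by (blast intro: order_antisym)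
  have "f x i = x i" for i
    using x fb[OF x(1)] by (cases "i < n") (auto simp: unit_box_def)
  then show ?thesis using x by blast
qed

section \<open>The KKM principle on the standard simplex\<close>

definition unit_simplex :: "nat \<Rightarrow> (nat \<Rightarrow> real) set"
  where "unit_simplex n = {t. (\<forall>i. 0 \<le> t i) \<and> (\<forall>i\<ge>n. t i = 0) \<and> (\<Sum>i<n. t i) = 1}"

lemma unit_simplex_subset_unit_box: "unit_simplex n \<subseteq> unit_box n"
proof
  fix t assume t: "t \<in> unit_simplex n"
  have "t i \<le> 1" if "i < n" for i
    using t member_le_sum[of i "{..<n}" t] that by (auto simp: unit_simplex_def)
  then show "t \<in> unit_box n" using t by (auto simp: unit_simplex_def unit_box_def)
qed

lemma continuous_on_coordinate:
  fixes S :: "('b \<Rightarrow> 'c::topological_space) set"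
  shows "continuous_on S (\<lambda>x. x i)"
  by (rule continuous_on_subset[OF continuous_on_product_coordinates]) simp

lemma closed_unit_simplex: "closed (unit_simplex n)"
proof -
  have "unit_simplex n = {t \<in> unit_box n. (\<Sum>i<n. t i) = 1}"
    using unit_simplex_subset_unit_box[of n]
    by (auto simp: unit_simplex_def unit_box_def) (metis linorder_not_le order_refl)
  moreover have "closed {t \<in> unit_box n. (\<Sum>i<n. t i) = 1}"
    by (intro continuous_closed_preimage_constant continuous_intros continuous_on_coordinate
        compact_imp_closed compact_unit_box)
  ultimately show ?thesis by simp
qed

text \<open>Transfers Brouwer's theorem from the box to the simplex. For \<open>n = 0\<close> the
  simplex is empty while the box is not.\<close>

lemma unit_simplex_retraction:
  assumes "0 < n"
  obtains r where "continuous_on (unit_box n) r" "r ` unit_box n \<subseteq> unit_simplex n"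
    "\<And>t. t \<in> unit_simplex n \<Longrightarrow> r t = t"
proof
  \<comment> \<open>Coordinate sums above 1 are scaled down, those below 1 are filled up evenly.\<close>
  define r where "r x = (\<lambda>i. if i < n then
    (x i + max 0 (1 - (\<Sum>j<n. x j)) / real n) / max 1 (\<Sum>j<n. x j) else (0::real))" for x
  show "continuous_on (unit_box n) r"
  proof (rule continuous_on_coordinatewise_then_product)
    fix i
    have "max 1 s \<noteq> 0" for s :: real by (simp add: max_def)
    then show "continuous_on (unit_box n) (\<lambda>x. r x i)"
      unfolding r_def
      by (cases "i < n") (auto intro!: continuous_intros continuous_on_coordinate continuous_on_max)
  qed
  show "r ` unit_box n \<subseteq> unit_simplex n"
  proof safe
    fix x assume x: "x \<in> unit_box n"
    have "(\<Sum>i<n. r x i) = (\<Sum>i<n. x i + max 0 (1 - (\<Sum>j<n. x j)) / real n) / max 1 (\<Sum>j<n. x j)"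
      by (simp add: r_def sum_divide_distrib)
    also have "(\<Sum>i<n. x i + max 0 (1 - (\<Sum>j<n. x j)) / real n) = max 1 (\<Sum>j<n. x j)"
      using assms by (simp add: sum.distrib max_def)
    finally have "(\<Sum>i<n. r x i) = 1" by simp
    then show "r x \<in> unit_simplex n"
      using x by (auto simp: unit_simplex_def r_def unit_box_def intro!: divide_nonneg_pos add_nonneg_nonneg)
  qed
  show "r t = t" if "t \<in> unit_simplex n" for t
    using that by (auto simp: r_def unit_simplex_def)
qed

text \<open>The indices with \<open>0 < t i\<close> span the smallest face containing
  \<open>t\<close>, so \<open>cover\<close> is the KKM condition for all faces at once. Without a
  common point the distances to the sets \<open>C i\<close> never vanish together, and normalising
  them gives a self-map of the simplex.\<close>

lemma KKM_unit_simplex: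
  fixes C :: "nat \<Rightarrow> (nat \<Rightarrow> real) set"
  assumes "0 < n" and cl: "\<And>i. i < n \<Longrightarrow> closed (C i)"
    and cover: "\<And>t. t \<in> unit_simplex n \<Longrightarrow> \<exists>i<n. 0 < t i \<and> t \<in> C i"
  shows "\<exists>t\<in>unit_simplex n. \<forall>i<n. t \<in> C i"
proof (rule ccontr)
  assume no: "\<not> ?thesis"
  \<comment> \<open>The distance to an empty set is 0 by convention, so this case must be excluded.
    Only the \<open>i\<close>-th coordinate of the \<open>i\<close>-th vertex is positive, which
    puts that vertex in \<open>C i\<close>.\<close>
  have ne: "C i \<noteq> {}" if "i < n" for i
  proof -
    have "(\<lambda>j. if j = i then 1 else 0) \<in> unit_simplex n"
      using that by (auto simp: unit_simplex_def)
    from cover[OF this] show ?thesis by (auto split: if_splits)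
  qed
  define total where "total t = (\<Sum>i<n. infdist t (C i))" for t
  have total: "0 < total t" if t: "t \<in> unit_simplex n" for t
  proof -
    obtain i where "i < n" "t \<notin> C i" using no t by blast
    then have "0 < infdist t (C i)" by (intro infdist_pos_not_in_closed cl ne)
    then show ?thesis
      unfolding total_def using \<open>i < n\<close> by (intro sum_pos2[of _ i]) (auto simp: infdist_nonneg)
  qed
  obtain r where r: "continuous_on (unit_box n) r" "r ` unit_box n \<subseteq> unit_simplex n"
    "\<And>t. t \<in> unit_simplex n \<Longrightarrow> r t = t"
    using unit_simplex_retraction[OF \<open>0 < n\<close>] by metis
  \<comment> \<open>A fixed point of \<open>g\<close> has \<open>t i > 0\<close> exactly where \<open>t \<notin> C i\<close>, against \<open>cover\<close>.\<close>
  define g where "g t = (\<lambda>i. if i < n then infdist t (C i) / total t else 0)" for t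
  have g: "g t \<in> unit_simplex n" if "t \<in> unit_simplex n" for t
    using total[OF that]
    by (auto simp: unit_simplex_def g_def total_def infdist_nonneg sum_nonneg
        simp flip: sum_divide_distrib)
  \<comment> \<open>A fixed point of \<open>g \<circ> r\<close> is a value of \<open>g\<close>, so
    it lies in the simplex, where \<open>r\<close> is the identity.\<close>
  have "\<exists>x\<in>unit_box n. (g \<circ> r) x = x"
  proof (rule brouwer_unit_box)
    have "continuous_on (unit_simplex n) (\<lambda>t. g t i)" for i
    proof (cases "i < n")
      case True
      have "continuous_on (unit_simplex n) (\<lambda>t. infdist t (C i) / total t)"
        using total unfolding total_def by (intro continuous_intros) force+
      then show ?thesis using True by (simp add: g_def)
    qed (simp add: g_def)
    then have "continuous_on (unit_simplex n) g"
      by (rule continuous_on_coordinatewise_then_product)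
    then show "continuous_on (unit_box n) (g \<circ> r)"
      using r by (meson continuous_on_compose continuous_on_subset)
    show "(g \<circ> r) ` unit_box n \<subseteq> unit_box n"
      using r(2) g unit_simplex_subset_unit_box by fastforce
  qed
  then obtain t where t: "t \<in> unit_box n" "g (r t) = t" by auto
  then have ts: "t \<in> unit_simplex n" using g r(2) by (metis image_subset_iff)
  then obtain i where i: "i < n" "0 < t i" "t \<in> C i" using cover by blast
  have "t i = infdist t (C i) / total t"
    using t(2) r(3)[OF ts] i(1) by (metis g_def)
  then show False using i by simp
qed

section \<open>The KKM principle in topological vector spaces\<close>

lemma tendsto_scaleR_topological_real_vector:
  fixes g :: "'b \<Rightarrow> 'a::topological_real_vector"
  assumes "(f \<longlongrightarrow> a) A" and "(g \<longlongrightarrow> x) A"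
  shows "((\<lambda>z. f z *\<^sub>R g z) \<longlongrightarrow> a *\<^sub>R x) A"
  using filterlim_compose[OF tendsto_scaleR_Pair filterlim_Pair[OF assms]] by simp

lemma continuous_on_scaleR_topological_real_vector:
  fixes g :: "'b::topological_space \<Rightarrow> 'a::topological_real_vector"
  assumes "continuous_on S f" and "continuous_on S g"
  shows "continuous_on S (\<lambda>z. f z *\<^sub>R g z)"
  using assms unfolding continuous_on_def by (blast intro: tendsto_scaleR_topological_real_vector)

text \<open>The barycentric map \<open>p\<close> pulls the sets \<open>G y\<close> back to the
  standard simplex. It may fail to be injective, so the points of \<open>Y\<close> can be affinely
  dependent.\<close>

lemma KKM:
  fixes G :: "'a::topological_real_vector \<Rightarrow> 'a set"
  assumes "finite Y" and "Y \<noteq> {}" and cl: "\<And>y. y \<in> Y \<Longrightarrow> closed (G y)"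
    and cover: "\<And>Z. Z \<subseteq> Y \<Longrightarrow> convex hull Z \<subseteq> (\<Union>z\<in>Z. G z)"
  shows "convex hull Y \<inter> (\<Inter>y\<in>Y. G y) \<noteq> {}"
proof -
  define n where "n = card Y"
  have "0 < n" using assms by (simp add: n_def card_gt_0_iff)
  obtain h where h: "bij_betw h {..<n} Y"
    using ex_bij_betw_nat_finite[OF \<open>finite Y\<close>] by (auto simp: n_def atLeast0LessThan)
  then have hY: "h ` {..<n} = Y" by (rule bij_betw_imp_surj_on)
  define p where "p t = (\<Sum>i<n. t i *\<^sub>R h i)" for t
  \<comment> \<open>Zero weights drop out, leaving just the vertices that
    \<open>KKM_unit_simplex\<close> admits for \<open>t\<close>.\<close>
  have p_hull: "p t \<in> convex hull (h ` {i. i < n \<and> 0 < t i})" if t: "t \<in> unit_simplex n" for t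
  proof -
    let ?I = "{i. i < n \<and> 0 < t i}"
    have z: "t i = 0" if "i \<in> {..<n} - ?I" for i
      using t that by (auto simp: unit_simplex_def order_antisym_conv not_less)
    have "p t = (\<Sum>i\<in>?I. t i *\<^sub>R h i)"
      unfolding p_def by (rule sum.mono_neutral_right) (use z in auto)
    moreover have "(\<Sum>i<n. t i) = (\<Sum>i\<in>?I. t i)"
      by (rule sum.mono_neutral_right) (use z in auto)
    then have "(\<Sum>i\<in>?I. t i) = 1" using t by (simp add: unit_simplex_def)
    moreover have "(\<Sum>i\<in>?I. t i *\<^sub>R h i) \<in> convex hull (h ` ?I)"
      by (rule convex_sum) (use \<open>sum t ?I = 1\<close> in \<open>auto intro: hull_inc\<close>)
    ultimately show ?thesis by simp
  qed
  have cp: "continuous_on (unit_simplex n) p"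
    unfolding p_def
    by (intro continuous_on_sum continuous_on_scaleR_topological_real_vector
        continuous_on_coordinate continuous_on_const)
  have "\<exists>t\<in>unit_simplex n. \<forall>i<n. t \<in> unit_simplex n \<inter> p -` G (h i)"
  proof (rule KKM_unit_simplex[OF \<open>0 < n\<close>])
    show "closed (unit_simplex n \<inter> p -` G (h i))" if "i < n" for i
      using cl hY that by (intro continuous_closed_preimage cp closed_unit_simplex) auto
    show "\<exists>i<n. 0 < t i \<and> t \<in> unit_simplex n \<inter> p -` G (h i)" if t: "t \<in> unit_simplex n" for t
    proof -
      have "p t \<in> (\<Union>z\<in>h ` {i. i < n \<and> 0 < t i}. G z)"
        using p_hull[OF t] cover[of "h ` {i. i < n \<and> 0 < t i}"] hY by blast
      then show ?thesis using t by blast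
    qed
  qed
  then obtain t where t: "t \<in> unit_simplex n" "\<And>i. i < n \<Longrightarrow> p t \<in> G (h i)" by blast
  have "p t \<in> convex hull Y"
    using p_hull[OF t(1)] hull_mono[of "h ` {i. i < n \<and> 0 < t i}" Y convex] hY by blast
  then show ?thesis using t(2) hY by blast
qed

section \<open>Density of self segment-dense sets in convex hulls\<close>

text \<open>Induction on \<open>Y\<close>: approximate the point of the smaller hull by a point of \<open>U\<close> first, so that
  density on the segment from that point to the new vertex applies.\<close>

lemma self_segment_dense_convex_hull:
  fixes U :: "'a::topological_real_vector set"
  assumes dense: "self_segment_dense U V" and "finite Y" and "Y \<subseteq> U"
  shows "convex hull Y \<subseteq> closure (convex hull Y \<inter> U)"
  using \<open>finite Y\<close> \<open>Y \<subseteq> U\<close>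
proof (induction Y)
  case empty
  then show ?case by simp
next
  case (insert a Y)
  show ?case
  proof (cases "Y = {}")
    case True
    then show ?thesis using insert.prems closure_subset by fastforce
  next
    case False
    let ?H = "convex hull insert a Y"
    show ?thesis
    proof
      fix z assume "z \<in> ?H"
      then obtain u v b where uv: "u \<ge> 0" "v \<ge> 0" "u + v = 1" and b: "b \<in> convex hull Y"
        and z: "z = u *\<^sub>R a + v *\<^sub>R b"
        unfolding convex_hull_insert[OF False] by blast
      \<comment> \<open>By induction \<open>b\<close> is in the closure on the left; continuity of
        the map reduces the claim to points \<open>w\<close> that belong to
        \<open>U\<close>.\<close>
      have "(\<lambda>w. u *\<^sub>R a + v *\<^sub>R w) ` closure (convex hull Y \<inter> U) \<subseteq> closure (?H \<inter> U)"
      proof (rule image_closure_subset)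
        show "continuous_on (closure (convex hull Y \<inter> U)) (\<lambda>w. u *\<^sub>R a + v *\<^sub>R w)"
          by (intro continuous_on_add continuous_on_scaleR_topological_real_vector
              continuous_on_const continuous_on_id)
        show "(\<lambda>w. u *\<^sub>R a + v *\<^sub>R w) ` (convex hull Y \<inter> U) \<subseteq> closure (?H \<inter> U)"
        proof
          fix x assume "x \<in> (\<lambda>w. u *\<^sub>R a + v *\<^sub>R w) ` (convex hull Y \<inter> U)"
          then obtain w where w: "w \<in> convex hull Y" "w \<in> U" and x: "x = u *\<^sub>R a + v *\<^sub>R w"
            by blast
          have "u = 1 - v" "v \<le> 1" using uv by auto
          then have "x \<in> closed_segment a w"
            using uv(2) x unfolding closed_segment_def by blast
          also have "closed_segment a w \<subseteq> closure (closed_segment a w \<inter> U)"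
            using dense w insert.prems by (auto simp: self_segment_dense_def)
          also have "closed_segment a w \<subseteq> ?H"
            using w hull_mono[of Y "insert a Y" convex]
            by (intro closed_segment_subset) (auto intro: hull_inc)
          then have "closure (closed_segment a w \<inter> U) \<subseteq> closure (?H \<inter> U)"
            by (intro closure_mono) blast
          finally show "x \<in> closure (?H \<inter> U)" .
        qed
      qed simp
      then show "z \<in> closure (?H \<inter> U)"
        using insert b z by blast
    qed
  qed
qed

section \<open>Lower semicontinuous and convex set-valued maps\<close>

text \<open>On the complement in \<open>K\<close>, \<open>T\<close> meets the open positive
  half-line, an open condition by lower semicontinuity. Lower semicontinuity on all of
  \<open>K\<close> makes the domain equal to \<open>K\<close>, so it controls every nearby
  point.\<close>

lemma sv_lsc_on_closed_nonpos:
  fixes T :: "'a::topological_space \<Rightarrow> real set"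
  assumes lsc: "sv_lsc_on K T K" and "closed K"
  shows "closed {x \<in> K. \<forall>u\<in>T x. u \<le> 0}"
proof -
  have "openin (top_of_set K) {x \<in> K. \<exists>u\<in>T x. 0 < u}"
  proof (subst openin_subopen, safe)
    fix x u assume x: "x \<in> K" and u: "u \<in> T x" "0 < u"
    have at: "sv_lsc_at K T x" and dom: "sv_domain K T = K"
      using lsc x by (auto simp: sv_lsc_on_def sv_lsc_at_def sv_domain_def)
    have "T x \<inter> {0<..} \<noteq> {}" using u by auto
    then obtain M where M: "openin (top_of_set K) M" "x \<in> M" "\<forall>y \<in> M \<inter> K. T y \<inter> {0<..} \<noteq> {}"
      using at dom unfolding sv_lsc_at_def by (metis open_greaterThan)
    have "M \<subseteq> {x \<in> K. \<exists>u\<in>T x. 0 < u}"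
    proof
      fix y assume "y \<in> M"
      then have "y \<in> K" using openin_imp_subset[OF M(1)] by blast
      then have "T y \<inter> {0<..} \<noteq> {}" using M(3) \<open>y \<in> M\<close> by blast
      then show "y \<in> {x \<in> K. \<exists>u\<in>T x. 0 < u}" using \<open>y \<in> K\<close> by auto
    qed
    then show "\<exists>M. openin (top_of_set K) M \<and> x \<in> M \<and> M \<subseteq> {x \<in> K. \<exists>u\<in>T x. 0 < u}"
      using M by blast
  qed
  then have "closedin (top_of_set K) (K - {x \<in> K. \<exists>u\<in>T x. 0 < u})"
    by (simp add: closedin_diff)
  moreover have "K - {x \<in> K. \<exists>u\<in>T x. 0 < u} = {x \<in> K. \<forall>u\<in>T x. u \<le> 0}"
    by (auto simp: not_less)
  ultimately show ?thesis
    using closedin_closed_trans[OF _ \<open>closed K\<close>] by simp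
qed

text \<open>The coefficients expressing \<open>x\<close> through \<open>Z\<close> combine positive
  values at points of \<open>Z\<close> into a value at \<open>x\<close>; as some coefficient is
  positive, so is that value.\<close>

lemma sv_convex_on_pos:
  fixes T :: "'a::real_vector \<Rightarrow> real set"
  assumes conv: "sv_convex_on D T" and "Z \<subseteq> D" and "x \<in> convex hull Z" and "x \<in> D"
    and pos: "\<And>z. z \<in> Z \<Longrightarrow> \<exists>u\<in>T z. 0 < u"
  shows "\<exists>u\<in>T x. 0 < u"
proof -
  obtain k l z where l: "\<forall>i\<in>{1::nat..k}. 0 \<le> l i \<and> z i \<in> Z" "sum l {1..k} = 1"
    and x: "(\<Sum>i = 1..k. l i *\<^sub>R z i) = x"
    using \<open>x \<in> convex hull Z\<close> unfolding convex_hull_indexed by blast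
  obtain w where w: "\<And>i. i \<in> {1..k} \<Longrightarrow> w i \<in> T (z i) \<and> 0 < w i"
  proof -
    have "\<forall>i\<in>{1..k}. \<exists>w. w \<in> T (z i) \<and> 0 < w" using pos l(1) by blast
    then show thesis using that by metis
  qed
  have "(\<Sum>i=1..k. l i *\<^sub>R w i) \<in> (\<Sum>i=1..k. (\<lambda>v. l i *\<^sub>R v) ` T (z i))"
    unfolding set_sum_alt[OF finite_atLeastAtMost] using w by blast
  also have "\<dots> \<subseteq> T x"
  proof -
    have "(\<forall>i\<in>{1..k}. z i \<in> D \<and> 0 \<le> l i) \<and> (\<Sum>i=1..k. l i) = 1 \<and> (\<Sum>i=1..k. l i *\<^sub>R z i) \<in> D"
      using l x \<open>x \<in> D\<close> \<open>Z \<subseteq> D\<close> by auto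
    then show ?thesis
      using conv x unfolding sv_convex_on_def by blast
  qed
  finally have in_T: "(\<Sum>i=1..k. l i *\<^sub>R w i) \<in> T x" .
  obtain j where j: "j \<in> {1..k}" "0 < l j"
    using l by (metis less_eq_real_def sum.neutral zero_neq_one)
  have "0 < (\<Sum>i=1..k. l i *\<^sub>R w i)"
  proof (rule sum_pos2[OF finite_atLeastAtMost j(1)])
    show "0 < l j *\<^sub>R w j" using j w by simp
    show "0 \<le> l i *\<^sub>R w i" if "i \<in> {1..k}" for i
      using that l(1) w[OF that] by simp
  qed
  then show ?thesis using in_T by blast
qed

section \<open>Existence of the point: finite intersections, compactness, extension to
  \<open>K\<close>\<close>

theorem theorem3p2:
  fixes K D :: "'a::{locally_convex_space, t2_space} set"
    and F :: "'a \<Rightarrow> 'a \<Rightarrow> real set"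
  assumes "K \<noteq> {}" and "convex K" and "compact K"
    and "D \<subseteq> K" and "self_segment_dense D K"
    and i: "\<And>y. y \<in> D \<Longrightarrow> sv_lsc_on K (\<lambda>x. F x y) K"
    and ii: "\<And>x. x \<in> K \<Longrightarrow> sv_lsc_on K (\<lambda>y. F x y) (K - D)"
    and iii: "\<And>x. x \<in> D \<Longrightarrow> sv_convex_on D (\<lambda>y. F x y)"
    and iv: "\<And>x. x \<in> D \<Longrightarrow> \<forall>u \<in> F x x. u \<le> 0"
  shows "\<exists>x0\<in>K. \<forall>y\<in>K. \<forall>u \<in> F x0 y. u \<le> 0"
proof -
  have dense: "K \<subseteq> closure D" using assms(5) by (simp add: self_segment_dense_def)
  define G where "G y = {x \<in> K. \<forall>u\<in>F x y. u \<le> 0}" for y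
  have clG: "closed (G y)" if "y \<in> D" for y
    unfolding G_def using i[OF that] compact_imp_closed[OF \<open>compact K\<close>]
    by (rule sv_lsc_on_closed_nonpos)
  have cover: "convex hull Z \<subseteq> (\<Union>z\<in>Z. G z)" if Z: "finite Z" "Z \<subseteq> D" for Z
  proof -
    have "convex hull Z \<subseteq> K"
      using Z \<open>D \<subseteq> K\<close> \<open>convex K\<close> by (intro hull_minimal) auto
    have "convex hull Z \<inter> D \<subseteq> (\<Union>z\<in>Z. G z)"
    proof
      fix x assume x: "x \<in> convex hull Z \<inter> D"
      show "x \<in> (\<Union>z\<in>Z. G z)"
      \<comment> \<open>Otherwise \<open>F x\<close> takes a positive value at each point of
        \<open>Z\<close>, hence by convexity at \<open>x\<close> itself, against
        \<open>iv\<close>.\<close>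
      proof (rule ccontr)
        assume "x \<notin> (\<Union>z\<in>Z. G z)"
        then have "\<exists>u\<in>F x z. 0 < u" if "z \<in> Z" for z
          using that x \<open>D \<subseteq> K\<close> by (auto simp: G_def not_le)
        then have "\<exists>u\<in>F x x. 0 < u"
          using sv_convex_on_pos[OF iii[of x] Z(2)] x by blast
        then show False using iv[of x] x by fastforce
      qed
    qed
    then have "closure (convex hull Z \<inter> D) \<subseteq> (\<Union>z\<in>Z. G z)"
      using Z clG by (intro closure_minimal closed_UN) auto
    then show ?thesis
      using self_segment_dense_convex_hull[OF assms(5) Z] by blast
  qed
  have "K \<inter> (\<Inter>y\<in>D. G y) \<noteq> {}"
  proof (rule compact_imp_fip_image[OF \<open>compact K\<close> clG])
    fix Y assume Y: "finite Y" "Y \<subseteq> D"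
    show "K \<inter> (\<Inter>y\<in>Y. G y) \<noteq> {}"
    \<comment> \<open>The empty subfamily is settled by \<open>K \<noteq> {}\<close>.\<close>
    proof (cases "Y = {}")
      case False
      have "convex hull Y \<inter> (\<Inter>y\<in>Y. G y) \<noteq> {}"
      proof (rule KKM[OF Y(1) False])
        show "closed (G y)" if "y \<in> Y" for y using clG Y(2) that by blast
        show "convex hull Z \<subseteq> (\<Union>z\<in>Z. G z)" if "Z \<subseteq> Y" for Z
          using Y that by (intro cover) (auto intro: finite_subset)
      qed
      moreover have "convex hull Y \<subseteq> K"
        using Y \<open>D \<subseteq> K\<close> \<open>convex K\<close> by (intro hull_minimal) auto
      ultimately show ?thesis by blast
    qed (simp add: \<open>K \<noteq> {}\<close>)
  qed
  then obtain x0 where x0: "x0 \<in> K" "\<And>y. y \<in> D \<Longrightarrow> \<forall>u\<in>F x0 y. u \<le> 0"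
    by (auto simp: G_def)
  have "u \<le> 0" if y: "y \<in> K" and u: "u \<in> F x0 y" for y u
  proof (rule ccontr)
    assume "\<not> u \<le> 0"
    then have ne: "F x0 y \<inter> {0<..} \<noteq> {}" using u by auto
    \<comment> \<open>The bound is known on \<open>D\<close>, so \<open>y\<close> lies where
      \<open>ii\<close> gives lower semicontinuity.\<close>
    have "y \<notin> D" using x0(2) u \<open>\<not> u \<le> 0\<close> by blast
    then have "sv_lsc_at K (F x0) y" using ii[OF x0(1)] y by (simp add: sv_lsc_on_def)
    then obtain M where M: "openin (top_of_set K) M" "y \<in> M"
      "\<forall>z \<in> M \<inter> sv_domain K (F x0). F x0 z \<inter> {0<..} \<noteq> {}"
      using ne unfolding sv_lsc_at_def by (metis open_greaterThan)
    \<comment> \<open>\<open>M\<close> is open only relative to \<open>K\<close>: density yields a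
      point of \<open>D\<close> in the open set \<open>W\<close>, and \<open>D \<subseteq> K\<close>
      puts it in \<open>M\<close>.\<close>
    then obtain W where W: "open W" "M = K \<inter> W" by (auto simp: openin_open)
    then have "W \<inter> D \<noteq> {}"
      using dense y M(2) open_Int_closure_eq_empty by fastforce
    then obtain d where d: "d \<in> D" "d \<in> M" using W \<open>D \<subseteq> K\<close> by blast
    \<comment> \<open>Condition (i) makes \<open>F x0 d\<close> nonempty, so that \<open>d\<close> is in the domain.\<close>
    have "F x0 d \<noteq> {}"
      using i[OF d(1)] x0(1) by (auto simp: sv_lsc_on_def sv_lsc_at_def sv_domain_def)
    then have "F x0 d \<inter> {0<..} \<noteq> {}"
      using M(3) d \<open>D \<subseteq> K\<close> by (auto simp: sv_domain_def)
    then show False using x0(2)[OF d(1)] by fastforce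
  qed
  then show ?thesis using x0(1) by blast
qed

end
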